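(* Let $G$ be a graph. The polytope of graph homomorphisms $P_{G\to\Lambda}$ is isomorphic to the stable set polytope of $G$.
   Context: Graphs are finite and undirected without multiple edges; loops are allowed. A graph homomorphism $G\to H$ is a map $\phi:V(G)\to V(H)$ with $\phi(u)\phi(v)\in E(H)$ whenever $uv\in E(G)$. For $e\in E(G)$ let $G[e]$ be the subgraph consisting only of $e$ and its endpoint(s). Let $E_{G,H}$ be the set of pairs $(e,\rho)$ with $e\in E(G)$ and $\rho:G[e]\to H$ a graph homomorphism. The polytope of graph homomorphisms $P_{G\to H}$ is the convex hull in $\mathbb{R}^{E_{G,H}}$ of the points $x_\phi$, one for each graph homomorphism $\phi:G\to H$, whose $(e,\rho)$-coordinate is $1$ if $\phi|_{G[e]}=\rho$ and $0$ otherwise. $\Lambda$ is the graph with two vertices joined by an edge and with a loop at exactly one of the two vertices. The stable set polytope of $G$ is the convex hull in $\mathbb{R}^{V(G)}$ of the $0/1$ indicator vectors of the stable (independent) sets of $G$. Isomorphic means affinely isomorphic: some affine map between the ambient spaces restricts to a bijection between the polytopes.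
   Formalization: Adds that every vertex of G lies on an edge (a loop counts): for a single vertex without edges the homomorphism polytope is a point but the stable set polytope is [0,1], and any isolated vertex makes the dimensions differ, so the claim fails for every excluded graph. *)

theory Defs
  imports "HOL-Analysis.Analysis" "HOL-Analysis.Finite_Function_Topology" "HOL-Library.FuncSet"
begin

section \<open>Graphs with loops and their homomorphisms\<close>

text \<open>An edge is the set of its endpoints, so a loop at \<open>v\<close> is the singleton \<open>{v}\<close>.\<close>

record 'a ugraph =
  verts :: "'a set"
  edges :: "'a set set"

definition fin_graph :: "'a ugraph \<Rightarrow> bool" where
  "fin_graph G \<longleftrightarrow>
     finite (verts G) \<and> (\<forall>e\<in>edges G. \<exists>u\<in>verts G. \<exists>v\<in>verts G. e = {u, v})"

text \<open>Homomorphisms are extensional functions, so that each map between the vertex sets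
  is represented by exactly one HOL function.\<close>

definition graph_homs :: "'a ugraph \<Rightarrow> 'b ugraph \<Rightarrow> ('a \<Rightarrow> 'b) set" where
  "graph_homs G H =
     {\<phi> \<in> verts G \<rightarrow>\<^sub>E verts H. \<forall>u v. {u, v} \<in> edges G \<longrightarrow> {\<phi> u, \<phi> v} \<in> edges H}"

text \<open>The graph \<open>G[e]\<close>.\<close>

definition edge_graph :: "'a set \<Rightarrow> 'a ugraph" where
  "edge_graph e = \<lparr>verts = e, edges = {e}\<rparr>"

definition edge_homs :: "'a ugraph \<Rightarrow> 'b ugraph \<Rightarrow> ('a set \<times> ('a \<Rightarrow> 'b)) set" where
  "edge_homs G H = (SIGMA e:edges G. graph_homs (edge_graph e) H)"

definition Lambda_graph :: "nat ugraph" where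
  "Lambda_graph = \<lparr>verts = {0, 1}, edges = {{0, 1}, {0}}\<rparr>"

definition stable_set :: "'a ugraph \<Rightarrow> 'a set \<Rightarrow> bool" where
  "stable_set G S \<longleftrightarrow> S \<subseteq> verts G \<and> (\<forall>u\<in>S. \<forall>v\<in>S. {u, v} \<notin> edges G)"


section \<open>Polytopes in coordinate spaces\<close>

text \<open>For a finite index set \<open>I\<close>, the space of real vectors indexed by \<open>I\<close> is realised as the
  subspace of those finitely supported functions that vanish outside \<open>I\<close>.\<close>

definition coord_space :: "'i set \<Rightarrow> ('i \<Rightarrow>\<^sub>0 real) set" where
  "coord_space I = {x. Poly_Mapping.keys x \<subseteq> I}"

definition coord_vec :: "'i set \<Rightarrow> ('i \<Rightarrow> real) \<Rightarrow> ('i \<Rightarrow>\<^sub>0 real)" where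
  "coord_vec I f = (\<Sum>i\<in>I. Poly_Mapping.single i (f i))"

lemma lookup_coord_vec:
  assumes "finite I"
  shows "Poly_Mapping.lookup (coord_vec I f) i = (if i \<in> I then f i else 0)"
  using assms by (simp add: coord_vec_def lookup_sum lookup_single when_def)

definition hom_point ::
  "'a ugraph \<Rightarrow> 'b ugraph \<Rightarrow> ('a \<Rightarrow> 'b) \<Rightarrow> ('a set \<times> ('a \<Rightarrow> 'b)) \<Rightarrow>\<^sub>0 real" where
  "hom_point G H \<phi> =
     coord_vec (edge_homs G H) (\<lambda>(e, \<rho>). if restrict \<phi> e = \<rho> then 1 else 0)"

definition hom_polytope ::
  "'a ugraph \<Rightarrow> 'b ugraph \<Rightarrow> (('a set \<times> ('a \<Rightarrow> 'b)) \<Rightarrow>\<^sub>0 real) set" where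
  "hom_polytope G H = convex hull (hom_point G H ` graph_homs G H)"

definition stable_set_polytope :: "'a ugraph \<Rightarrow> ('a \<Rightarrow>\<^sub>0 real) set" where
  "stable_set_polytope G = convex hull {coord_vec (verts G) (indicator S) | S. stable_set G S}"

definition affine_map ::
  "'v::real_vector set \<Rightarrow> 'w::real_vector set \<Rightarrow> ('v \<Rightarrow> 'w) \<Rightarrow> bool" where
  "affine_map A B f \<longleftrightarrow> f \<in> A \<rightarrow> B \<and>
     (\<forall>x\<in>A. \<forall>y\<in>A. \<forall>t::real. f ((1 - t) *\<^sub>R x + t *\<^sub>R y) = (1 - t) *\<^sub>R f x + t *\<^sub>R f y)"

text \<open>\<open>A\<close> and \<open>B\<close> are the ambient spaces of the polytopes \<open>P\<close> and \<open>Q\<close>.\<close>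

definition affinely_isomorphic ::
  "'v::real_vector set \<Rightarrow> 'v set \<Rightarrow> 'w::real_vector set \<Rightarrow> 'w set \<Rightarrow> bool" where
  "affinely_isomorphic A P B Q \<longleftrightarrow> (\<exists>f. affine_map A B f \<and> bij_betw f P Q)"


section \<open>Isolated vertices\<close>

text \<open>The coordinates of \<open>hom_polytope\<close> only see vertices that lie on an edge, whereas every
  vertex contributes a coordinate to \<open>stable_set_polytope\<close>. The two polytopes therefore differ
  in the presence of isolated vertices, the smallest case being a one-vertex graph.\<close>

definition no_isolated_vertices :: "'a ugraph \<Rightarrow> bool" where
  "no_isolated_vertices G \<longleftrightarrow> (\<forall>v\<in>verts G. \<exists>e\<in>edges G. v \<in> e)"

lemma not_isomorphic_single_vertex:
  fixes v :: 'a
  defines "G \<equiv> \<lparr>verts = {v}, edges = {}\<rparr>"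
  shows "fin_graph G"
    and "\<not> affinely_isomorphic
           (coord_space (edge_homs G Lambda_graph)) (hom_polytope G Lambda_graph)
           (coord_space (verts G)) (stable_set_polytope G)"
proof -
  show "fin_graph G" by (simp add: G_def fin_graph_def)
  have "hom_point G Lambda_graph \<phi> = 0" for \<phi>
    by (simp add: hom_point_def edge_homs_def coord_vec_def G_def)
  then have "hom_point G Lambda_graph ` graph_homs G Lambda_graph \<subseteq> {0}" by auto
  then have P: "hom_polytope G Lambda_graph \<subseteq> {0}"
    unfolding hom_polytope_def by (rule hull_minimal) simp
  have "stable_set G {}" "stable_set G {v}" by (auto simp: stable_set_def G_def)
  then have "coord_vec {v} (indicator {}) \<in> stable_set_polytope G"
    and "coord_vec {v} (indicator {v}) \<in> stable_set_polytope G"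
    unfolding stable_set_polytope_def by (force intro: hull_inc simp: G_def)+
  moreover have "coord_vec {v} (indicator {}) \<noteq> coord_vec {v} (indicator {v})"
  proof
    assume "coord_vec {v} (indicator {}) = coord_vec {v} (indicator {v})"
    then have "Poly_Mapping.lookup (coord_vec {v} (indicator {})) v
             = Poly_Mapping.lookup (coord_vec {v} (indicator {v})) v" by simp
    then show False by (simp add: lookup_coord_vec)
  qed
  ultimately have Q: "\<not> stable_set_polytope G \<subseteq> {z}" for z
    by (metis singletonD subsetD)
  show "\<not> affinely_isomorphic
           (coord_space (edge_homs G Lambda_graph)) (hom_polytope G Lambda_graph)
           (coord_space (verts G)) (stable_set_polytope G)"
  proof
    assume "affinely_isomorphic
           (coord_space (edge_homs G Lambda_graph)) (hom_polytope G Lambda_graph)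
           (coord_space (verts G)) (stable_set_polytope G)"
    then obtain f where "f ` hom_polytope G Lambda_graph = stable_set_polytope G"
      unfolding affinely_isomorphic_def bij_betw_def by metis
    then have "stable_set_polytope G \<subseteq> {f 0}" using image_mono[OF P, of f] by simp
    then show False using Q by metis
  qed
qed

end

theory Submission
  imports Defs
begin

text \<open>A homomorphism \<open>\<phi>\<close> to \<open>\<Lambda>\<close> is determined by the stable set of vertices sent to the loopless
  vertex \<open>1\<close>. The indicator of this set at \<open>v\<close> is the sum of the coordinates of \<open>x\<^sub>\<phi>\<close> at \<open>(e, \<rho>)\<close>
  with \<open>\<rho> v = 1\<close>, for any fixed edge \<open>e\<close> at \<open>v\<close>; this gives a linear map between the polytopes that
  is onto on generators. It is injective because it has an affine left inverse: at most one
  endpoint of an edge \<open>e\<close> lies in a stable set, so the coordinate of \<open>x\<^sub>\<phi>\<close> at \<open>(e, \<rho>)\<close> is the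
  indicator value at the endpoint which \<open>\<rho>\<close> sends to \<open>1\<close>, and if there is none it is one minus
  the sum of the indicator values at the endpoints.\<close>

lemma lookup_scaleR:
  "Poly_Mapping.lookup (r *\<^sub>R x) i = r *\<^sub>R Poly_Mapping.lookup x i"
proof -
  \<comment> \<open>\<open>scaleR\<close> is defined through \<open>Abs_poly_mapping\<close>, which
    can be unfolded only on functions of finite support.\<close>
  have "finite {i. r *\<^sub>R Poly_Mapping.lookup x i \<noteq> 0}"
    by (rule finite_subset[OF _ finite_lookup[of x]]) auto
  then show ?thesis
    by (simp add: scaleR_poly_mapping_def Abs_poly_mapping_inverse)
qed

lemma fin_graph_edgeE:
  assumes "fin_graph G" "e \<in> edges G"
  obtains u v where "u \<in> verts G" "v \<in> verts G" "e = {u, v}"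
  using assms unfolding fin_graph_def by blast

lemma fin_graph_edge_subset:
  assumes "fin_graph G" "e \<in> edges G"
  shows "e \<subseteq> verts G" "finite e"
  using assms by (auto elim: fin_graph_edgeE)

lemma Lambda_graph_edge_iff:
  "{i, j} \<in> edges Lambda_graph \<longleftrightarrow> i \<in> {0, 1} \<and> j \<in> {0, 1} \<and> \<not> (i = 1 \<and> j = 1)"
  by (auto simp: Lambda_graph_def doubleton_eq_iff)

lemma graph_homs_edge_graph_Lambda_iff:
  "\<rho> \<in> graph_homs (edge_graph {u, v}) Lambda_graph \<longleftrightarrow>
     \<rho> \<in> {u, v} \<rightarrow>\<^sub>E {0, 1} \<and> \<not> (\<rho> u = 1 \<and> \<rho> v = 1)"
  unfolding graph_homs_def Lambda_graph_edge_iff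
  by (auto simp: edge_graph_def Lambda_graph_def doubleton_eq_iff)

text \<open>Finiteness of the index set is what lets \<open>lookup_coord_vec\<close> read off the
  coordinates of \<open>hom_point\<close>.\<close>

lemma finite_edge_homs_Lambda:
  assumes "fin_graph G"
  shows "finite (edge_homs G Lambda_graph)"
  unfolding edge_homs_def
proof (intro finite_SigmaI)
  have "edges G \<subseteq> Pow (verts G)"
    using fin_graph_edge_subset(1)[OF assms] by blast
  then show "finite (edges G)"
    using assms finite_subset unfolding fin_graph_def by blast
  fix e assume "e \<in> edges G"
  then have "finite (e \<rightarrow>\<^sub>E verts Lambda_graph)"
    using fin_graph_edge_subset(2)[OF assms] by (intro finite_PiE) (auto simp: Lambda_graph_def)
  then show "finite (graph_homs (edge_graph e) Lambda_graph)"
    by (rule rev_finite_subset) (auto simp: graph_homs_def edge_graph_def)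
qed

lemma restrict_edge_hom:
  assumes "e \<in> edges G" "e \<subseteq> verts G" "\<phi> \<in> graph_homs G H"
  shows "restrict \<phi> e \<in> graph_homs (edge_graph e) H"
  using assms by (auto simp: graph_homs_def edge_graph_def PiE_iff subset_iff)

text \<open>The pair \<open>1\<close>, \<open>1\<close> is the only one not joined in \<Lambda>, so
  no edge of \<open>G\<close> has all its endpoints sent to \<open>1\<close>; for a loop this
  excludes its vertex from the set.\<close>

lemma stable_set_of_hom:
  assumes "\<phi> \<in> graph_homs G Lambda_graph"
  shows "stable_set G {v \<in> verts G. \<phi> v = 1}"
  using assms by (auto simp: stable_set_def graph_homs_def Lambda_graph_edge_iff)

lemma hom_of_stable_set:
  assumes "fin_graph G" "stable_set G S"
  shows "restrict (indicator S) (verts G) \<in> graph_homs G Lambda_graph"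
proof -
  have "\<not> (u \<in> S \<and> v \<in> S) \<and> u \<in> verts G \<and> v \<in> verts G" if "{u, v} \<in> edges G" for u v
    using that assms fin_graph_edge_subset(1)[OF assms(1) that] by (auto simp: stable_set_def)
  then show ?thesis
    unfolding graph_homs_def Lambda_graph_edge_iff
    by (auto simp: Lambda_graph_def indicator_def)
qed

lemma image_hom_stable_sets:
  assumes "fin_graph G"
  shows "(\<lambda>\<phi>. {v \<in> verts G. \<phi> v = 1}) ` graph_homs G Lambda_graph = {S. stable_set G S}"
proof (intro equalityI subsetI)
  fix S assume "S \<in> {S. stable_set G S}"
  then have S: "stable_set G S" by simp
  then have "S = {v \<in> verts G. restrict (indicator S) (verts G) v = (1::nat)}"
    by (auto simp: stable_set_def indicator_def)
  then show "S \<in> (\<lambda>\<phi>. {v \<in> verts G. \<phi> v = 1}) ` graph_homs G Lambda_graph"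
    using hom_of_stable_set[OF assms S] by blast
qed (auto simp del: One_nat_def intro: stable_set_of_hom)

text \<open>The function \<open>c\<close> is meant to pick an edge at each vertex. On the points
  \<open>hom_point\<close> the value does not depend on that choice.\<close>

definition Lambda_to_stable ::
  "'a ugraph \<Rightarrow> ('a \<Rightarrow> 'a set) \<Rightarrow> (('a set \<times> ('a \<Rightarrow> nat)) \<Rightarrow>\<^sub>0 real) \<Rightarrow> ('a \<Rightarrow>\<^sub>0 real)" where
  "Lambda_to_stable G c x = coord_vec (verts G) (\<lambda>v.
     \<Sum>\<rho>\<in>{\<rho> \<in> graph_homs (edge_graph (c v)) Lambda_graph. \<rho> v = 1}. Poly_Mapping.lookup x (c v, \<rho>))"

text \<open>The weight \<open>real (\<rho> w)\<close> selects the endpoint sent to \<open>1\<close>.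
  Summing over the set \<open>e\<close> counts the vertex of a loop once.\<close>

definition stable_to_Lambda ::
  "'a ugraph \<Rightarrow> ('a \<Rightarrow>\<^sub>0 real) \<Rightarrow> (('a set \<times> ('a \<Rightarrow> nat)) \<Rightarrow>\<^sub>0 real)" where
  "stable_to_Lambda G y = coord_vec (edge_homs G Lambda_graph) (\<lambda>(e, \<rho>).
     if 1 \<in> \<rho> ` e then \<Sum>w\<in>e. real (\<rho> w) * Poly_Mapping.lookup y w
     else 1 - (\<Sum>w\<in>e. Poly_Mapping.lookup y w))"

lemma linear_Lambda_to_stable:
  assumes "finite (verts G)"
  shows "linear (Lambda_to_stable G c)"
  by (rule linearI; rule poly_mapping_eqI)
    (auto simp: Lambda_to_stable_def lookup_coord_vec assms lookup_add lookup_scaleR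
      sum.distrib sum_distrib_left)

text \<open>The constant \<open>1\<close> in the second branch prevents linearity, but it survives
  combinations whose coefficients sum to one.\<close>

lemma affine_stable_to_Lambda:
  assumes "finite (edge_homs G Lambda_graph)"
  shows "affine_map UNIV UNIV (stable_to_Lambda G)"
  unfolding affine_map_def
proof (intro conjI ballI allI poly_mapping_eqI)
  fix x y t and i :: "'a set \<times> ('a \<Rightarrow> nat)"
  show "Poly_Mapping.lookup (stable_to_Lambda G ((1 - t) *\<^sub>R x + t *\<^sub>R y)) i =
        Poly_Mapping.lookup ((1 - t) *\<^sub>R stable_to_Lambda G x + t *\<^sub>R stable_to_Lambda G y) i"
    by (cases i, simp add: stable_to_Lambda_def lookup_coord_vec[OF assms] lookup_add lookup_scaleR)
      (simp add: sum.distrib sum_subtractf sum_distrib_left algebra_simps)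
qed auto

lemma Lambda_to_stable_hom_point:
  assumes G: "fin_graph G" and c: "\<And>v. v \<in> verts G \<Longrightarrow> c v \<in> edges G \<and> v \<in> c v"
    and \<phi>: "\<phi> \<in> graph_homs G Lambda_graph"
  shows "Lambda_to_stable G c (hom_point G Lambda_graph \<phi>) =
         coord_vec (verts G) (indicator {v \<in> verts G. \<phi> v = 1})"
proof (rule poly_mapping_eqI)
  fix v
  have fin: "finite (verts G)" using G by (simp add: fin_graph_def)
  note finE = finite_edge_homs_Lambda[OF G]
  let ?L = "Poly_Mapping.lookup"
  let ?R = "{\<rho> \<in> graph_homs (edge_graph (c v)) Lambda_graph. \<rho> v = 1}"
  show "?L (Lambda_to_stable G c (hom_point G Lambda_graph \<phi>)) v =
        ?L (coord_vec (verts G) (indicator {v \<in> verts G. \<phi> v = 1})) v"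
  proof (cases "v \<in> verts G")
    case True
    then have e: "c v \<in> edges G" "v \<in> c v" using c by auto
    \<comment> \<open>Pairing with \<open>c v\<close> embeds \<open>?R\<close> into the finite set
      \<open>edge_homs G Lambda_graph\<close>.\<close>
    have "finite (Pair (c v) ` ?R)"
      using e by (intro finite_subset[OF _ finE]) (auto simp: edge_homs_def)
    then have finR: "finite ?R"
      by (rule finite_imageD) (simp add: inj_on_def)
    have res: "restrict \<phi> (c v) \<in> graph_homs (edge_graph (c v)) Lambda_graph"
      using e fin_graph_edge_subset(1)[OF G] \<phi> by (intro restrict_edge_hom) auto
    have "(\<Sum>\<rho>\<in>?R. ?L (hom_point G Lambda_graph \<phi>) (c v, \<rho>)) =
          (\<Sum>\<rho>\<in>?R. if restrict \<phi> (c v) = \<rho> then 1 else 0)"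
      using e by (intro sum.cong refl) (simp add: hom_point_def lookup_coord_vec[OF finE], simp add: edge_homs_def)
    \<comment> \<open>Only \<open>restrict \<phi> (c v)\<close> can contribute, and it belongs to
      \<open>?R\<close> exactly when \<open>\<phi> v = 1\<close>.\<close>
    also have "\<dots> = (if \<phi> v = 1 then 1 else 0)"
      using finR res e by (subst sum.delta') auto
    finally show ?thesis
      using True by (simp add: Lambda_to_stable_def lookup_coord_vec fin)
  qed (simp add: Lambda_to_stable_def lookup_coord_vec fin)
qed

lemma stable_to_Lambda_indicator:
  assumes G: "fin_graph G" and \<phi>: "\<phi> \<in> graph_homs G Lambda_graph"
  shows "stable_to_Lambda G (coord_vec (verts G) (indicator {v \<in> verts G. \<phi> v = 1})) =
         hom_point G Lambda_graph \<phi>"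
proof -
  let ?y = "coord_vec (verts G) (indicator {v \<in> verts G. \<phi> v = 1}) :: 'a \<Rightarrow>\<^sub>0 real"
  have fin: "finite (verts G)" using G by (simp add: fin_graph_def)
  have "(if 1 \<in> \<rho> ` e then \<Sum>w\<in>e. real (\<rho> w) * Poly_Mapping.lookup ?y w
         else 1 - (\<Sum>w\<in>e. Poly_Mapping.lookup ?y w)) = (if restrict \<phi> e = \<rho> then 1 else 0)"
    if e: "e \<in> edges G" and hom: "\<rho> \<in> graph_homs (edge_graph e) Lambda_graph" for e \<rho>
  proof -
    obtain u v where uv: "u \<in> verts G" "v \<in> verts G" "e = {u, v}"
      using fin_graph_edgeE[OF G e] .
    have \<rho>: "\<rho> \<in> {u, v} \<rightarrow>\<^sub>E {0, 1}" "\<not> (\<rho> u = 1 \<and> \<rho> v = 1)"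
      using hom unfolding uv graph_homs_edge_graph_Lambda_iff by auto
    have \<phi>': "\<phi> u \<in> {0, 1}" "\<phi> v \<in> {0, 1}" "\<not> (\<phi> u = 1 \<and> \<phi> v = 1)"
      using \<phi> e unfolding uv graph_homs_def Lambda_graph_edge_iff by auto
    have "restrict \<phi> e = \<rho> \<longleftrightarrow> (\<forall>w\<in>e. \<phi> w = \<rho> w)"
      using \<rho>(1) unfolding uv by (auto simp: fun_eq_iff PiE_iff extensional_def)
    then have eq: "restrict \<phi> e = \<rho> \<longleftrightarrow> \<phi> u = \<rho> u \<and> \<phi> v = \<rho> v"
      by (simp add: uv)
    have y: "Poly_Mapping.lookup ?y u = real (\<phi> u)" "Poly_Mapping.lookup ?y v = real (\<phi> v)"
      using uv \<phi>' by (auto simp: lookup_coord_vec fin)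
    have im: "1 \<in> \<rho> ` e \<longleftrightarrow> \<rho> u = 1 \<or> \<rho> v = 1"
      unfolding uv by auto
    have vals: "\<rho> u = 0 \<or> \<rho> u = 1" "\<rho> v = 0 \<or> \<rho> v = 1" "\<phi> u = 0 \<or> \<phi> u = 1" "\<phi> v = 0 \<or> \<phi> v = 1"
      using \<rho>(1) \<phi>' by auto
    show ?thesis
    \<comment> \<open>For a loop, \<open>\<rho>\<close> and \<open>\<phi>\<close> must both be
      \<open>0\<close> at \<open>u\<close>, so both sides are \<open>1\<close>. Otherwise the sums
      have two terms and the finitely many \<open>0\<close>/\<open>1\<close> values are
      checked.\<close>
    proof (cases "u = v")
      case True
      then show ?thesis
        unfolding eq im unfolding uv(3) using vals \<rho>(2) \<phi>'(3) y by simp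
    next
      case False
      then have sums: "(\<Sum>w\<in>e. f w) = f u + f v" for f :: "'a \<Rightarrow> real"
        by (simp add: uv(3))
      from vals show ?thesis
        unfolding eq im sums y using \<rho>(2) \<phi>'(3) by (elim disjE) simp_all
    qed
  qed
  then show ?thesis
    unfolding stable_to_Lambda_def hom_point_def coord_vec_def
    by (intro sum.cong) (auto simp: edge_homs_def)
qed

text \<open>The composite of \<open>f\<close> and \<open>g\<close> is affine, so it commutes with
  convex combinations of its fixed points.\<close>

lemma convex_affine_fixpoints:
  assumes "linear f" "affine_map UNIV UNIV g"
  shows "convex {x. g (f x) = x}"
proof (rule convexI)
  fix x y and s t :: real
  assume xy: "x \<in> {x. g (f x) = x}" "y \<in> {x. g (f x) = x}" and "s + t = 1"
  then have s: "s = 1 - t" by simp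
  have "g (f ((1 - t) *\<^sub>R x + t *\<^sub>R y)) = g ((1 - t) *\<^sub>R f x + t *\<^sub>R f y)"
    by (simp only: linear_add[OF assms(1)] linear_scale[OF assms(1)])
  also have "\<dots> = (1 - t) *\<^sub>R x + t *\<^sub>R y"
    using assms(2) xy by (simp add: affine_map_def)
  finally show "s *\<^sub>R x + t *\<^sub>R y \<in> {x. g (f x) = x}"
    by (simp add: s)
qed

text \<open>Being inverted by \<open>g\<close> passes from the generators to their hull by convexity
  of the fixed points; surjectivity holds since linear maps commute with convex hulls.\<close>

lemma bij_betw_convex_hulls:
  assumes f: "linear f" and g: "affine_map UNIV UNIV g"
    and inv: "\<And>x. x \<in> X \<Longrightarrow> g (f x) = x"
  shows "bij_betw f (convex hull X) (convex hull (f ` X))"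
proof -
  have "convex hull X \<subseteq> {x. g (f x) = x}"
    using inv by (intro hull_minimal convex_affine_fixpoints f g) auto
  then have "inj_on f (convex hull X)"
    by (intro inj_on_inverseI[where g = g]) auto
  then show ?thesis
    by (simp add: bij_betw_def convex_hull_linear_image[OF f])
qed

theorem proposition9p6:
  fixes G :: "'a ugraph"
  assumes "fin_graph G"
    and "no_isolated_vertices G"
  shows "affinely_isomorphic
           (coord_space (edge_homs G Lambda_graph)) (hom_polytope G Lambda_graph)
           (coord_space (verts G)) (stable_set_polytope G)"
proof -
  have fin: "finite (verts G)" using assms(1) by (simp add: fin_graph_def)
  \<comment> \<open>An edge at each vertex exists because no vertex is isolated.\<close>
  obtain c where c: "\<And>v. v \<in> verts G \<Longrightarrow> c v \<in> edges G \<and> v \<in> c v"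
    using assms(2) unfolding no_isolated_vertices_def by metis
  let ?f = "Lambda_to_stable G c"
  let ?X = "hom_point G Lambda_graph ` graph_homs G Lambda_graph"
  have lin: "linear ?f" by (rule linear_Lambda_to_stable[OF fin])
  note point = Lambda_to_stable_hom_point[OF assms(1) c]
  have "?f ` ?X = (\<lambda>S. coord_vec (verts G) (indicator S)) `
      (\<lambda>\<phi>. {v \<in> verts G. \<phi> v = 1}) ` graph_homs G Lambda_graph"
    unfolding image_image by (rule image_cong[OF refl point])
  also have "\<dots> = {coord_vec (verts G) (indicator S) | S. stable_set G S}"
    unfolding image_hom_stable_sets[OF assms(1)] by auto
  finally have "convex hull (?f ` ?X) = stable_set_polytope G"
    by (simp add: stable_set_polytope_def)
  moreover have "bij_betw ?f (convex hull ?X) (convex hull (?f ` ?X))"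
    using affine_stable_to_Lambda[OF finite_edge_homs_Lambda[OF assms(1)]]
    by (rule bij_betw_convex_hulls[OF lin])
      (auto simp: point stable_to_Lambda_indicator[OF assms(1)] simp del: One_nat_def)
  \<comment> \<open>\<open>coord_vec\<close> vanishes outside its index set, whatever
    \<open>x\<close> is.\<close>
  moreover have "?f x \<in> coord_space (verts G)" for x
    by (auto simp: coord_space_def Lambda_to_stable_def lookup_coord_vec[OF fin] in_keys_iff split: if_splits)
  then have "affine_map (coord_space (edge_homs G Lambda_graph)) (coord_space (verts G)) ?f"
    unfolding affine_map_def by (simp add: linear_add[OF lin] linear_scale[OF lin])
  ultimately show ?thesis
    unfolding affinely_isomorphic_def hom_polytope_def by metis
qed

end
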